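(* Let $(E,G,\varphi)$ be an Exel-Pardo system. Then the resulting Zappa-Szép product $E^*\rtimes^\varphi G$ is a singly aligned left cancellative small category.
   Context: Exel-Pardo systems: $E=(E^0,E^1,r,s)$ is a directed graph and $G$ is a discrete group acting on $E^0$ and on $E^1$ with $r(ge)=gr(e)$, $s(ge)=gs(e)$. A graph cocycle is a map $\varphi\colon G\times E^1\to G$ with $\varphi(gh,e)=\varphi(g,he)\varphi(h,e)$ and $\varphi(g,e)s(e)=gs(e)$ for all $g,h\in G$, $e\in E^1$; then $(E,G,\varphi)$ is an Exel-Pardo system. $E^*$ is the category of finite paths in $E$ (vertices are the paths of length $0$; a path of length $n\ge1$ is $e_1\cdots e_n$ with $s(e_i)=r(e_{i+1})$, range $r(e_1)$, source $s(e_n)$; composition is concatenation). The action and $\varphi$ extend uniquely to a group action of $G$ on the set $E^*$ and a map $\varphi\colon G\times E^*\to G$ with $\varphi(g,v)=g$ for $v\in E^0$ and, inductively, $g(e\alpha)=(ge)(\varphi(g,e)\alpha)$, $\varphi(g,e\alpha)=\varphi(\varphi(g,e),\alpha)$ for $e\in E^1$, $\alpha\in E^*$ composable. These extensions satisfy, for all $g,h\in G$ and composable $\alpha,\beta\in E^*$: $r(g\alpha)=gr(\alpha)$, $s(g\alpha)=gs(\alpha)$, $\varphi(gh,\alpha)=\varphi(g,h\alpha)\varphi(h,\alpha)$, $\varphi(g,\alpha)s(\alpha)=gs(\alpha)$, $g(\alpha\beta)=(g\alpha)(\varphi(g,\alpha)\beta)$, $\varphi(g,\alpha\beta)=\varphi(\varphi(g,\alpha),\beta)$.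 Zappa-Szép product: $\mathcal{D}=E^*\rtimes^\varphi G$ is the set $E^*\times G$ with vertex set $\mathcal{D}^0=E^0\times\{1\}$, $r(\alpha,g)=(r(\alpha),1)$, $s(\alpha,g)=(g^{-1}s(\alpha),1)$, and $(\alpha,g)(\beta,h)=(\alpha(g\beta),\varphi(g,\beta)h)$ when $s(\alpha,g)=r(\beta,h)$. A small category $\mathcal{D}$ (identified with its set of morphisms, $xy$ defined iff $s(x)=r(y)$) is left cancellative if $xy=xz$ implies $y=z$; with $x\mathcal{D}=\{xy:r(y)=s(x)\}$, a left cancellative $\mathcal{D}$ is singly aligned if for all $x,y\in\mathcal{D}$ either $x\mathcal{D}\cap y\mathcal{D}=\varnothing$ or there is $z\in\mathcal{D}$ with $x\mathcal{D}\cap y\mathcal{D}=z\mathcal{D}$. *)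

theory Defs
  imports "Graph_Theory.Digraph" "HOL-Algebra.Group_Action"
begin

section \<open>Small categories, identified with their sets of morphisms\<close>

text \<open>Objects are identified with their identity morphisms, so the vertex set is a subset of
  the set of morphisms. The product \<open>cmp D x y\<close> is meaningful only for \<open>x, y\<close> in \<open>mor D\<close> with
  \<open>src D x = rng D y\<close>; its value elsewhere is irrelevant.\<close>

record 'm category_data =
  mor :: "'m set"
  vert :: "'m set"
  rng :: "'m \<Rightarrow> 'm"
  src :: "'m \<Rightarrow> 'm"
  cmp :: "'m \<Rightarrow> 'm \<Rightarrow> 'm"

locale small_category =
  fixes D :: "'m category_data"
  assumes vert_subset: "vert D \<subseteq> mor D"
    and rng_in_vert: "x \<in> mor D \<Longrightarrow> rng D x \<in> vert D"
    and src_in_vert: "x \<in> mor D \<Longrightarrow> src D x \<in> vert D"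
    and rng_vert: "v \<in> vert D \<Longrightarrow> rng D v = v"
    and src_vert: "v \<in> vert D \<Longrightarrow> src D v = v"
    and cmp_closed: "\<lbrakk>x \<in> mor D; y \<in> mor D; src D x = rng D y\<rbrakk> \<Longrightarrow> cmp D x y \<in> mor D"
    and rng_cmp: "\<lbrakk>x \<in> mor D; y \<in> mor D; src D x = rng D y\<rbrakk> \<Longrightarrow> rng D (cmp D x y) = rng D x"
    and src_cmp: "\<lbrakk>x \<in> mor D; y \<in> mor D; src D x = rng D y\<rbrakk> \<Longrightarrow> src D (cmp D x y) = src D y"
    and cmp_rng_left: "x \<in> mor D \<Longrightarrow> cmp D (rng D x) x = x"
    and cmp_src_right: "x \<in> mor D \<Longrightarrow> cmp D x (src D x) = x"
    and cmp_assoc: "\<lbrakk>x \<in> mor D; y \<in> mor D; z \<in> mor D; src D x = rng D y; src D y = rng D z\<rbrakk>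
      \<Longrightarrow> cmp D (cmp D x y) z = cmp D x (cmp D y z)"

definition left_cancellative :: "'m category_data \<Rightarrow> bool" where
  "left_cancellative D \<longleftrightarrow>
    (\<forall>x\<in>mor D. \<forall>y\<in>mor D. \<forall>z\<in>mor D.
      src D x = rng D y \<longrightarrow> src D x = rng D z \<longrightarrow> cmp D x y = cmp D x z \<longrightarrow> y = z)"

definition right_ideal :: "'m category_data \<Rightarrow> 'm \<Rightarrow> 'm set" where
  "right_ideal D x = {cmp D x y | y. y \<in> mor D \<and> rng D y = src D x}"

definition singly_aligned :: "'m category_data \<Rightarrow> bool" where
  "singly_aligned D \<longleftrightarrow>
    (\<forall>x\<in>mor D. \<forall>y\<in>mor D.
      right_ideal D x \<inter> right_ideal D y = {} \<or>
      (\<exists>z\<in>mor D. right_ideal D x \<inter> right_ideal D y = right_ideal D z))"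


section \<open>Exel-Pardo systems\<close>

text \<open>For an edge \<open>e\<close> of the directed graph \<open>E\<close>, the range \<open>r(e)\<close> is \<open>head E e\<close> and the source
  \<open>s(e)\<close> is \<open>tail E e\<close>. The actions of \<open>G\<close> on vertices and edges are \<open>aV\<close> and \<open>aE\<close>.\<close>

locale exel_pardo_system =
  graph: wf_digraph E +
  vertices: group_action G "verts E" aV +
  edges: group_action G "arcs E" aE
  for E :: "('v, 'e) pre_digraph" (structure)
    and G :: "('g, 'x) monoid_scheme" (structure)
    and aV :: "'g \<Rightarrow> 'v \<Rightarrow> 'v" and aE :: "'g \<Rightarrow> 'e \<Rightarrow> 'e" +
  fixes \<phi> :: "'g \<Rightarrow> 'e \<Rightarrow> 'g"
  assumes range_equivariant:
      "\<lbrakk>g \<in> carrier G; e \<in> arcs E\<rbrakk> \<Longrightarrow> head E (aE g e) = aV g (head E e)"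
    and source_equivariant:
      "\<lbrakk>g \<in> carrier G; e \<in> arcs E\<rbrakk> \<Longrightarrow> tail E (aE g e) = aV g (tail E e)"
    and cocycle_closed:
      "\<lbrakk>g \<in> carrier G; e \<in> arcs E\<rbrakk> \<Longrightarrow> \<phi> g e \<in> carrier G"
    and cocycle_mult:
      "\<lbrakk>g \<in> carrier G; h \<in> carrier G; e \<in> arcs E\<rbrakk>
        \<Longrightarrow> \<phi> (g \<otimes>\<^bsub>G\<^esub> h) e = \<phi> g (aE h e) \<otimes>\<^bsub>G\<^esub> \<phi> h e"
    and cocycle_source:
      "\<lbrakk>g \<in> carrier G; e \<in> arcs E\<rbrakk> \<Longrightarrow> aV (\<phi> g e) (tail E e) = aV g (tail E e)"


section \<open>Finite paths\<close>

text \<open>\<open>Step e \<alpha>\<close> is the composite of the edge \<open>e\<close> with the path \<open>\<alpha>\<close>, where \<open>s(e) = r(\<alpha>)\<close>. A path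
  ends with its source vertex: \<open>e\<^sub>1 \<cdots> e\<^sub>n\<close> is \<open>Step e\<^sub>1 (\<dots> (Step e\<^sub>n (Vertex s(e\<^sub>n))))\<close>, and
  an edge \<open>e\<close>, viewed as a path of length one, is \<open>Step e (Vertex s(e))\<close>.\<close>

datatype ('v, 'e) path = Vertex 'v | Step 'e "('v, 'e) path"

primrec path_range :: "('v, 'e) pre_digraph \<Rightarrow> ('v, 'e) path \<Rightarrow> 'v" where
  "path_range E (Vertex v) = v"
| "path_range E (Step e \<alpha>) = head E e"

primrec path_source :: "('v, 'e) path \<Rightarrow> 'v" where
  "path_source (Vertex v) = v"
| "path_source (Step e \<alpha>) = path_source \<alpha>"

inductive_set paths :: "('v, 'e) pre_digraph \<Rightarrow> ('v, 'e) path set"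
  for E :: "('v, 'e) pre_digraph" where
  Vertex: "v \<in> verts E \<Longrightarrow> Vertex v \<in> paths E"
| Step: "\<lbrakk>e \<in> arcs E; \<alpha> \<in> paths E; tail E e = path_range E \<alpha>\<rbrakk> \<Longrightarrow> Step e \<alpha> \<in> paths E"

primrec path_concat :: "('v, 'e) path \<Rightarrow> ('v, 'e) path \<Rightarrow> ('v, 'e) path" where
  "path_concat (Vertex v) \<beta> = \<beta>"
| "path_concat (Step e \<alpha>) \<beta> = Step e (path_concat \<alpha> \<beta>)"

primrec path_action :: "('g \<Rightarrow> 'v \<Rightarrow> 'v) \<Rightarrow> ('g \<Rightarrow> 'e \<Rightarrow> 'e) \<Rightarrow> ('g \<Rightarrow> 'e \<Rightarrow> 'g) \<Rightarrow>
    'g \<Rightarrow> ('v, 'e) path \<Rightarrow> ('v, 'e) path" where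
  "path_action aV aE \<phi> g (Vertex v) = Vertex (aV g v)"
| "path_action aV aE \<phi> g (Step e \<alpha>) = Step (aE g e) (path_action aV aE \<phi> (\<phi> g e) \<alpha>)"

primrec path_cocycle :: "('g \<Rightarrow> 'e \<Rightarrow> 'g) \<Rightarrow> 'g \<Rightarrow> ('v, 'e) path \<Rightarrow> 'g" where
  "path_cocycle \<phi> g (Vertex v) = g"
| "path_cocycle \<phi> g (Step e \<alpha>) = path_cocycle \<phi> (\<phi> g e) \<alpha>"


section \<open>The Zappa-Szep product\<close>

definition zappa_szep ::
  "('v, 'e) pre_digraph \<Rightarrow> ('g, 'x) monoid_scheme \<Rightarrow> ('g \<Rightarrow> 'v \<Rightarrow> 'v) \<Rightarrow> ('g \<Rightarrow> 'e \<Rightarrow> 'e) \<Rightarrow>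
    ('g \<Rightarrow> 'e \<Rightarrow> 'g) \<Rightarrow> (('v, 'e) path \<times> 'g) category_data" where
  "zappa_szep E G aV aE \<phi> =
    \<lparr> mor = paths E \<times> carrier G,
      vert = Vertex ` verts E \<times> {\<one>\<^bsub>G\<^esub>},
      rng = (\<lambda>(\<alpha>, g). (Vertex (path_range E \<alpha>), \<one>\<^bsub>G\<^esub>)),
      src = (\<lambda>(\<alpha>, g). (Vertex (aV (inv\<^bsub>G\<^esub> g) (path_source \<alpha>)), \<one>\<^bsub>G\<^esub>)),
      cmp = (\<lambda>(\<alpha>, g) (\<beta>, h).
        (path_concat \<alpha> (path_action aV aE \<phi> g \<beta>), path_cocycle \<phi> g \<beta> \<otimes>\<^bsub>G\<^esub> h)) \<rparr>"

end

theory Submission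
  imports Defs
begin

text \<open>Two paths in \<open>E\<close> with a common extension are comparable: one is an initial segment of the
  other, as in a free monoid. So \<open>E\<^sup>*\<close> is left cancellative and singly aligned, and the point is
  that passing to the Zappa-Szep product changes nothing essential. Each \<open>(s(\<alpha>), g)\<close> is
  invertible, so \<open>(\<alpha>, g) = (\<alpha>, 1) (s(\<alpha>), g)\<close> and \<open>(\<alpha>, 1)\<close> generate the same right ideal. It
  consists of all \<open>(\<gamma>, k)\<close> such that \<open>\<gamma>\<close> extends \<open>\<alpha>\<close>, with \<open>k\<close> arbitrary
  (lemma \<open>right_ideal_zappa_szep\<close>). Two such right ideals therefore are disjoint or nested,
  because the paths they come from are incomparable or comparable (lemma \<open>path_prefix_comparable\<close>).
  Left cancellation follows from that in \<open>E\<^sup>*\<close> and in \<open>G\<close>, since every \<open>g\<close> acts injectively on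
  paths.

  The category axioms reduce to the usual identities for the extended action and cocycle. Of
  these, the one for sources takes the form \<open>s(g\<alpha>) = \<phi>(g, \<alpha>) s(\<alpha>)\<close>: this is what an induction
  on \<open>\<alpha>\<close> yields from \<open>\<phi>(g, e) s(e) = g s(e)\<close>, and it is exactly the compatibility that makes
  \<open>g(\<alpha>\<beta>) = (g\<alpha>) (\<phi>(g, \<alpha>)\<beta>)\<close> a composable product and gives \<open>(\<alpha>, g) (\<beta>, h)\<close> the source of
  \<open>(\<beta>, h)\<close>.\<close>


section \<open>Concatenation of paths\<close>

lemma path_range_concat:
  "path_source \<alpha> = path_range E \<beta> \<Longrightarrow> path_range E (path_concat \<alpha> \<beta>) = path_range E \<alpha>"
  by (cases \<alpha>) auto

lemma path_source_concat: "path_source (path_concat \<alpha> \<beta>) = path_source \<beta>"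
  by (induction \<alpha>) auto

lemma path_concat_in_paths:
  assumes "\<alpha> \<in> paths E" "\<beta> \<in> paths E" "path_source \<alpha> = path_range E \<beta>"
  shows "path_concat \<alpha> \<beta> \<in> paths E"
  using assms by (induction rule: paths.induct) (auto intro: paths.Step simp: path_range_concat)

lemma path_concat_assoc:
  "path_concat (path_concat \<alpha> \<beta>) \<gamma> = path_concat \<alpha> (path_concat \<beta> \<gamma>)"
  by (induction \<alpha>) auto

lemma path_concat_source: "path_concat \<alpha> (Vertex (path_source \<alpha>)) = \<alpha>"
  by (induction \<alpha>) auto

lemma path_concat_left_cancel: "path_concat \<alpha> \<beta> = path_concat \<alpha> \<gamma> \<Longrightarrow> \<beta> = \<gamma>"
  by (induction \<alpha>) auto

definition extensions :: "('v, 'e) pre_digraph \<Rightarrow> ('v, 'e) path \<Rightarrow> ('v, 'e) path set" where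
  "extensions E \<alpha> = {path_concat \<alpha> \<delta> | \<delta>. \<delta> \<in> paths E \<and> path_range E \<delta> = path_source \<alpha>}"

lemma extensions_mono:
  assumes "\<beta> \<in> extensions E \<alpha>"
  shows "extensions E \<beta> \<subseteq> extensions E \<alpha>"
proof
  fix \<gamma> assume "\<gamma> \<in> extensions E \<beta>"
  then obtain \<epsilon> where \<epsilon>: "\<gamma> = path_concat \<beta> \<epsilon>" "\<epsilon> \<in> paths E" "path_range E \<epsilon> = path_source \<beta>"
    unfolding extensions_def by blast
  from assms obtain \<delta> where
    \<delta>: "\<beta> = path_concat \<alpha> \<delta>" "\<delta> \<in> paths E" "path_range E \<delta> = path_source \<alpha>"
    unfolding extensions_def by blast
  have "\<gamma> = path_concat \<alpha> (path_concat \<delta> \<epsilon>)"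
    using \<epsilon>(1) \<delta>(1) by (simp add: path_concat_assoc)
  moreover have "path_concat \<delta> \<epsilon> \<in> paths E" "path_range E (path_concat \<delta> \<epsilon>) = path_source \<alpha>"
    using \<epsilon> \<delta> by (simp_all add: path_concat_in_paths path_range_concat path_source_concat)
  ultimately show "\<gamma> \<in> extensions E \<alpha>"
    unfolding extensions_def by blast
qed

text \<open>Matching the edges of the common extension from the left exhausts one of the two paths
  first; that path is an initial segment of the other. When only its vertex is left, that vertex
  is the range of what is left of the other path, because both are the range of what is left of
  the common extension.\<close>

lemma path_prefix_comparable:
  assumes "\<alpha> \<in> paths E" "\<beta> \<in> paths E" "\<gamma> \<in> extensions E \<alpha>" "\<gamma> \<in> extensions E \<beta>"
  shows "\<beta> \<in> extensions E \<alpha> \<or> \<alpha> \<in> extensions E \<beta>"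
  using assms
proof (induction arbitrary: \<beta> \<gamma> rule: paths.induct)
  case (Vertex v)
  then have "path_range E \<beta> = v"
    by (auto simp: extensions_def path_range_concat)
  with Vertex.prems show ?case
    by (simp add: extensions_def)
next
  case (Step e \<alpha>)
  note hyps = Step.hyps and prems = Step.prems and IH = Step.IH
  show ?case
  proof (cases \<beta>)
    case (Vertex w)
    with prems have "path_range E (Step e \<alpha>) = w"
      by (auto simp: extensions_def)
    with Vertex hyps show ?thesis
      by (auto simp: extensions_def intro: paths.Step)
  next
    case (Step f \<beta>')
    from prems Step obtain \<gamma>' where "f = e" "\<gamma>' \<in> extensions E \<alpha>" "\<gamma>' \<in> extensions E \<beta>'"
      by (auto simp: extensions_def)
    moreover from prems Step have "\<beta>' \<in> paths E"
      by (auto elim: paths.cases)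
    ultimately have "\<beta>' \<in> extensions E \<alpha> \<or> \<alpha> \<in> extensions E \<beta>'"
      using IH by blast
    with \<open>f = e\<close> Step show ?thesis
      by (auto simp: extensions_def)
  qed
qed


section \<open>The action and the cocycle on paths\<close>

context exel_pardo_system
begin

abbreviation act where "act \<equiv> path_action aV aE \<phi>"
abbreviation coc where "coc \<equiv> path_cocycle \<phi>"

lemma aV_closed: "\<lbrakk>g \<in> carrier G; v \<in> verts E\<rbrakk> \<Longrightarrow> aV g v \<in> verts E"
  using vertices.element_image by blast

lemma aE_closed: "\<lbrakk>g \<in> carrier G; e \<in> arcs E\<rbrakk> \<Longrightarrow> aE g e \<in> arcs E"
  using edges.element_image by blast

lemma aV_one: "v \<in> verts E \<Longrightarrow> aV \<one>\<^bsub>G\<^esub> v = v"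
  using vertices.id_eq_one by (metis restrict_apply')

lemma aE_one: "e \<in> arcs E \<Longrightarrow> aE \<one>\<^bsub>G\<^esub> e = e"
  using edges.id_eq_one by (metis restrict_apply')

lemma is_group: "group G"
  using vertices.group_hom group_hom.axioms(1) by blast

lemma inv_mem: "g \<in> carrier G \<Longrightarrow> inv\<^bsub>G\<^esub> g \<in> carrier G"
  using is_group by (rule group.inv_closed)

lemma aV_inv_eq_iff:
  assumes "g \<in> carrier G" "v \<in> verts E" "w \<in> verts E"
  shows "aV (inv\<^bsub>G\<^esub> g) v = w \<longleftrightarrow> v = aV g w"
  using assms inv_mem group.inv_inv[OF is_group] vertices.orbit_sym_aux by metis

lemma path_range_verts: "\<alpha> \<in> paths E \<Longrightarrow> path_range E \<alpha> \<in> verts E"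
  by (induction rule: paths.induct) auto

lemma path_source_verts: "\<alpha> \<in> paths E \<Longrightarrow> path_source \<alpha> \<in> verts E"
  by (induction rule: paths.induct) auto

lemma path_range_action:
  "\<lbrakk>\<alpha> \<in> paths E; g \<in> carrier G\<rbrakk> \<Longrightarrow> path_range E (act g \<alpha>) = aV g (path_range E \<alpha>)"
  by (induction rule: paths.induct) (auto simp: range_equivariant)

lemma path_cocycle_closed: "\<lbrakk>\<alpha> \<in> paths E; g \<in> carrier G\<rbrakk> \<Longrightarrow> coc g \<alpha> \<in> carrier G"
  by (induction arbitrary: g rule: paths.induct) (auto simp: cocycle_closed)

lemma path_action_closed: "\<lbrakk>\<alpha> \<in> paths E; g \<in> carrier G\<rbrakk> \<Longrightarrow> act g \<alpha> \<in> paths E"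
proof (induction arbitrary: g rule: paths.induct)
  case (Vertex v)
  then show ?case by (auto intro: paths.Vertex aV_closed)
next
  case (Step e \<alpha>)
  then have "tail E (aE g e) = path_range E (act (\<phi> g e) \<alpha>)"
    by (metis cocycle_closed cocycle_source path_range_action source_equivariant)
  with Step show ?case
    by (auto intro!: paths.Step aE_closed cocycle_closed)
qed

text \<open>Moving along \<open>\<alpha>\<close>, the acting group element is replaced by its cocycle value at each edge,
  so what acts on the source at the end is \<open>\<phi>(g, \<alpha>)\<close> and not \<open>g\<close>.\<close>

lemma path_source_action:
  "\<lbrakk>\<alpha> \<in> paths E; g \<in> carrier G\<rbrakk> \<Longrightarrow> path_source (act g \<alpha>) = aV (coc g \<alpha>) (path_source \<alpha>)"
  by (induction arbitrary: g rule: paths.induct) (auto simp: cocycle_closed)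

lemma path_action_mult:
  "\<lbrakk>\<alpha> \<in> paths E; g \<in> carrier G; h \<in> carrier G\<rbrakk> \<Longrightarrow> act (g \<otimes>\<^bsub>G\<^esub> h) \<alpha> = act g (act h \<alpha>)"
  by (induction arbitrary: g h rule: paths.induct)
    (auto simp: vertices.composition_rule edges.composition_rule cocycle_mult cocycle_closed aE_closed)

lemma path_cocycle_mult:
  "\<lbrakk>\<alpha> \<in> paths E; g \<in> carrier G; h \<in> carrier G\<rbrakk>
    \<Longrightarrow> coc (g \<otimes>\<^bsub>G\<^esub> h) \<alpha> = coc g (act h \<alpha>) \<otimes>\<^bsub>G\<^esub> coc h \<alpha>"
  by (induction arbitrary: g h rule: paths.induct)
    (auto simp: cocycle_mult cocycle_closed aE_closed)

text \<open>The cocycle identity for \<open>1 = 1 1\<close> makes \<open>\<phi>(1, e)\<close> an idempotent of \<open>G\<close>.\<close>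

lemma cocycle_one:
  assumes "e \<in> arcs E"
  shows "\<phi> \<one>\<^bsub>G\<^esub> e = \<one>\<^bsub>G\<^esub>"
proof -
  interpret G: group G by (rule is_group)
  have "\<phi> \<one>\<^bsub>G\<^esub> e \<otimes>\<^bsub>G\<^esub> \<phi> \<one>\<^bsub>G\<^esub> e = \<phi> \<one>\<^bsub>G\<^esub> e"
    using cocycle_mult[of "\<one>\<^bsub>G\<^esub>" "\<one>\<^bsub>G\<^esub>" e] assms by (simp add: aE_one)
  then show ?thesis
    using assms by (simp add: cocycle_closed)
qed

lemma path_action_one: "\<alpha> \<in> paths E \<Longrightarrow> act \<one>\<^bsub>G\<^esub> \<alpha> = \<alpha>"
  by (induction rule: paths.induct) (auto simp: aV_one aE_one cocycle_one)

lemma path_cocycle_one: "\<alpha> \<in> paths E \<Longrightarrow> coc \<one>\<^bsub>G\<^esub> \<alpha> = \<one>\<^bsub>G\<^esub>"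
  by (induction rule: paths.induct) (auto simp: cocycle_one)

lemma path_action_inv:
  assumes "\<alpha> \<in> paths E" "g \<in> carrier G"
  shows "act g (act (inv\<^bsub>G\<^esub> g) \<alpha>) = \<alpha>" "act (inv\<^bsub>G\<^esub> g) (act g \<alpha>) = \<alpha>"
proof -
  interpret G: group G by (rule is_group)
  show "act g (act (inv\<^bsub>G\<^esub> g) \<alpha>) = \<alpha>" "act (inv\<^bsub>G\<^esub> g) (act g \<alpha>) = \<alpha>"
    using assms by (simp_all add: path_action_mult[symmetric] path_action_one)
qed

lemma path_action_concat: "act g (path_concat \<alpha> \<beta>) = path_concat (act g \<alpha>) (act (coc g \<alpha>) \<beta>)"
  by (induction \<alpha> arbitrary: g) auto

lemma path_cocycle_concat: "coc g (path_concat \<alpha> \<beta>) = coc (coc g \<alpha>) \<beta>"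
  by (induction \<alpha> arbitrary: g) auto


section \<open>The Zappa-Szep product\<close>

abbreviation ZS where "ZS \<equiv> zappa_szep E G aV aE \<phi>"

text \<open>This turns composability in the Zappa-Szep product into composability of the paths that
  the product concatenates.\<close>

lemma src_eq_rng_zappa_szep_iff:
  assumes "\<alpha> \<in> paths E" "g \<in> carrier G" "\<beta> \<in> paths E"
  shows "src ZS (\<alpha>, g) = rng ZS (\<beta>, h) \<longleftrightarrow> path_source \<alpha> = path_range E (act g \<beta>)"
  using assms
  by (simp add: zappa_szep_def aV_inv_eq_iff path_source_verts path_range_verts path_range_action)

lemma small_category_zappa_szep: "small_category ZS"
proof -
  interpret G: group G by (rule is_group)
  have closed: "cmp ZS (\<alpha>, g) (\<beta>, h) \<in> mor ZS"
    and range: "rng ZS (cmp ZS (\<alpha>, g) (\<beta>, h)) = rng ZS (\<alpha>, g)"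
    and source: "src ZS (cmp ZS (\<alpha>, g) (\<beta>, h)) = src ZS (\<beta>, h)"
    if "\<alpha> \<in> paths E" "g \<in> carrier G" "\<beta> \<in> paths E" "h \<in> carrier G"
      and comp: "src ZS (\<alpha>, g) = rng ZS (\<beta>, h)" for \<alpha> g \<beta> h
  proof -
    have s: "path_source \<alpha> = path_range E (act g \<beta>)"
      using that by (simp add: src_eq_rng_zappa_szep_iff)
    show "cmp ZS (\<alpha>, g) (\<beta>, h) \<in> mor ZS" "rng ZS (cmp ZS (\<alpha>, g) (\<beta>, h)) = rng ZS (\<alpha>, g)"
      using s that(1-4)
      by (simp_all add: zappa_szep_def path_concat_in_paths path_action_closed
          path_cocycle_closed path_range_concat)
    let ?k = "coc g \<beta>"
    have k: "?k \<in> carrier G" and sv: "path_source \<beta> \<in> verts E"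
      using that by (simp_all add: path_cocycle_closed path_source_verts)
    \<comment> \<open>The product ends at \<open>s(g\<beta>) = \<phi>(g, \<beta>) s(\<beta>)\<close>, and the cocycle value cancels against the
      inverse of the group component \<open>\<phi>(g, \<beta>) h\<close>, which leaves \<open>inv(h) s(\<beta>)\<close>.\<close>
    have "aV (inv\<^bsub>G\<^esub> (?k \<otimes>\<^bsub>G\<^esub> h)) (aV ?k (path_source \<beta>)) = aV (inv\<^bsub>G\<^esub> h) (path_source \<beta>)"
      using k sv \<open>h \<in> carrier G\<close>
      by (simp add: G.inv_mult_group vertices.composition_rule aV_closed vertices.orbit_sym_aux)
    then show "src ZS (cmp ZS (\<alpha>, g) (\<beta>, h)) = src ZS (\<beta>, h)"
      using that by (simp add: zappa_szep_def path_source_concat path_source_action)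
  qed
  show ?thesis
  proof
    show "vert ZS \<subseteq> mor ZS"
      by (auto simp: zappa_szep_def intro: paths.Vertex)
    show "rng ZS x \<in> vert ZS" if "x \<in> mor ZS" for x
      using that by (auto simp: zappa_szep_def path_range_verts)
    show "src ZS x \<in> vert ZS" if "x \<in> mor ZS" for x
      using that by (auto simp: zappa_szep_def path_source_verts aV_closed)
    show "rng ZS v = v" "src ZS v = v" if "v \<in> vert ZS" for v
      using that by (auto simp: zappa_szep_def aV_one)
    show "cmp ZS (rng ZS x) x = x" if "x \<in> mor ZS" for x
      using that by (auto simp: zappa_szep_def path_action_one path_cocycle_one)
    show "cmp ZS x (src ZS x) = x" if "x \<in> mor ZS" for x
      using that
      by (auto simp: zappa_szep_def path_concat_source path_source_verts aV_closed
          vertices.composition_rule[symmetric] aV_one)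
    show "cmp ZS (cmp ZS x y) z = cmp ZS x (cmp ZS y z)"
      if "x \<in> mor ZS" "y \<in> mor ZS" "z \<in> mor ZS" for x y z
      using that
      by (auto simp: zappa_szep_def path_action_concat path_cocycle_concat path_concat_assoc
          path_action_mult path_cocycle_mult path_cocycle_closed path_action_closed G.m_assoc)
  qed (use closed range source in \<open>auto simp: zappa_szep_def\<close>)
qed

lemma left_cancellative_zappa_szep: "left_cancellative ZS"
  unfolding left_cancellative_def
proof (intro ballI impI)
  interpret G: group G by (rule is_group)
  fix x y z
  assume "x \<in> mor ZS" "y \<in> mor ZS" "z \<in> mor ZS" and eq: "cmp ZS x y = cmp ZS x z"
  then obtain \<alpha> g \<beta> h \<gamma> k where x: "x = (\<alpha>, g)" "\<alpha> \<in> paths E" "g \<in> carrier G"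
    and y: "y = (\<beta>, h)" "\<beta> \<in> paths E" "h \<in> carrier G"
    and z: "z = (\<gamma>, k)" "\<gamma> \<in> paths E" "k \<in> carrier G"
    by (auto simp: zappa_szep_def)
  have "act g \<beta> = act g \<gamma>"
    using eq x y z by (auto simp: zappa_szep_def dest: path_concat_left_cancel)
  then have "\<beta> = \<gamma>"
    using x y z path_action_inv(2) by metis
  moreover have "coc g \<beta> \<otimes>\<^bsub>G\<^esub> h = coc g \<gamma> \<otimes>\<^bsub>G\<^esub> k"
    using eq x y z by (simp add: zappa_szep_def)
  ultimately show "y = z"
    using x y z by (simp add: path_cocycle_closed)
qed

text \<open>To reach \<open>(\<alpha>\<delta>, k)\<close> from \<open>(\<alpha>, g)\<close>, solve \<open>g\<beta> = \<delta>\<close> and then \<open>\<phi>(g, \<beta>) h = k\<close>; both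
  equations are solvable because \<open>g\<close> permutes the paths and \<open>G\<close> is a group.\<close>

lemma right_ideal_zappa_szep:
  assumes "\<alpha> \<in> paths E" "g \<in> carrier G"
  shows "right_ideal ZS (\<alpha>, g) = extensions E \<alpha> \<times> carrier G"
proof (intro equalityI subsetI)
  fix x assume "x \<in> right_ideal ZS (\<alpha>, g)"
  then obtain y where y: "x = cmp ZS (\<alpha>, g) y" "y \<in> mor ZS" "src ZS (\<alpha>, g) = rng ZS y"
    unfolding right_ideal_def by auto
  then obtain \<beta> h where \<beta>: "y = (\<beta>, h)" "\<beta> \<in> paths E" "h \<in> carrier G"
    by (auto simp: zappa_szep_def)
  with assms y have "path_source \<alpha> = path_range E (act g \<beta>)"
    by (simp add: src_eq_rng_zappa_szep_iff)
  moreover have "coc g \<beta> \<otimes>\<^bsub>G\<^esub> h \<in> carrier G"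
    using \<beta> assms path_cocycle_closed is_group group.is_monoid monoid.m_closed by metis
  ultimately show "x \<in> extensions E \<alpha> \<times> carrier G"
    using y \<beta> assms by (auto simp: zappa_szep_def extensions_def path_action_closed)
next
  interpret G: group G by (rule is_group)
  fix x assume "x \<in> extensions E \<alpha> \<times> carrier G"
  then obtain \<delta> k where x: "x = (path_concat \<alpha> \<delta>, k)" "\<delta> \<in> paths E" "k \<in> carrier G"
    and r: "path_range E \<delta> = path_source \<alpha>"
    by (auto simp: extensions_def)
  define \<beta> where "\<beta> = act (inv\<^bsub>G\<^esub> g) \<delta>"
  define h where "h = inv\<^bsub>G\<^esub> (coc g \<beta>) \<otimes>\<^bsub>G\<^esub> k"
  have \<beta>: "\<beta> \<in> paths E" "act g \<beta> = \<delta>"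
    using assms x by (simp_all add: \<beta>_def path_action_closed path_action_inv)
  have c: "coc g \<beta> \<in> carrier G"
    using assms \<beta> by (simp add: path_cocycle_closed)
  have h: "h \<in> carrier G" "coc g \<beta> \<otimes>\<^bsub>G\<^esub> h = k"
    using c x by (simp_all add: h_def G.m_assoc[symmetric])
  have "x = cmp ZS (\<alpha>, g) (\<beta>, h)" "(\<beta>, h) \<in> mor ZS"
    using x \<beta> h by (simp_all add: zappa_szep_def)
  moreover have "rng ZS (\<beta>, h) = src ZS (\<alpha>, g)"
    using src_eq_rng_zappa_szep_iff[of \<alpha> g \<beta> h] assms \<beta> r by simp
  ultimately show "x \<in> right_ideal ZS (\<alpha>, g)"
    unfolding right_ideal_def by blast
qed

lemma singly_aligned_zappa_szep: "singly_aligned ZS"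
  unfolding singly_aligned_def
proof (intro ballI)
  fix x y assume xy: "x \<in> mor ZS" "y \<in> mor ZS"
  then obtain \<alpha> g \<beta> h where x: "x = (\<alpha>, g)" "\<alpha> \<in> paths E" "g \<in> carrier G"
    and y: "y = (\<beta>, h)" "\<beta> \<in> paths E" "h \<in> carrier G"
    by (auto simp: zappa_szep_def)
  have ideals: "right_ideal ZS x = extensions E \<alpha> \<times> carrier G"
    "right_ideal ZS y = extensions E \<beta> \<times> carrier G"
    using x y by (simp_all add: right_ideal_zappa_szep)
  have "right_ideal ZS x \<inter> right_ideal ZS y = {} \<or>
    right_ideal ZS x \<subseteq> right_ideal ZS y \<or> right_ideal ZS y \<subseteq> right_ideal ZS x"
  proof (cases "extensions E \<alpha> \<inter> extensions E \<beta> = {}")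
    case True
    then show ?thesis
      by (auto simp: ideals)
  next
    case False
    then have "\<beta> \<in> extensions E \<alpha> \<or> \<alpha> \<in> extensions E \<beta>"
      using path_prefix_comparable x y by blast
    then show ?thesis
      using extensions_mono unfolding ideals by blast
  qed
  then show "right_ideal ZS x \<inter> right_ideal ZS y = {} \<or>
      (\<exists>z\<in>mor ZS. right_ideal ZS x \<inter> right_ideal ZS y = right_ideal ZS z)"
    using xy by (metis Int_absorb1 Int_absorb2)
qed

end

theorem corollary4p14:
  fixes E :: "('v, 'e) pre_digraph"
    and G :: "('g, 'x) monoid_scheme"
    and aV :: "'g \<Rightarrow> 'v \<Rightarrow> 'v"
    and aE :: "'g \<Rightarrow> 'e \<Rightarrow> 'e"
    and \<phi> :: "'g \<Rightarrow> 'e \<Rightarrow> 'g"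
  assumes "exel_pardo_system E G aV aE \<phi>"
  shows "small_category (zappa_szep E G aV aE \<phi>) \<and>
    left_cancellative (zappa_szep E G aV aE \<phi>) \<and>
    singly_aligned (zappa_szep E G aV aE \<phi>)"
proof -
  interpret exel_pardo_system E G aV aE \<phi>
    by (rule assms)
  show ?thesis
    using small_category_zappa_szep left_cancellative_zappa_szep singly_aligned_zappa_szep by blast
qed

end
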